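(* (Multiple bus mergers.) Let a power grid containing switches or busbar couplers $e_1,\dots,e_M$ be given, and assume that the grid is connected even if all these switches are open. Let $\boldsymbol B_r$ be the grounded Laplacian of the grid with all switches open, $\boldsymbol U=(\boldsymbol\nu_{e_1}\ \cdots\ \boldsymbol\nu_{e_M})$, $\boldsymbol K=\boldsymbol U^\top\boldsymbol B_r^{-1}\boldsymbol U$, and let $\boldsymbol K_d$ be the diagonal matrix with the same diagonal as $\boldsymbol K$. Let a switch setting be given, i.e. a set $S\subseteq\{1,\dots,M\}$ of closed switches, and let $\boldsymbol\Xi=\mathrm{diag}(\xi_1,\dots,\xi_M)$ with $\xi_i=1$ if $i\in S$ (switch $e_i$ closed) and $\xi_i=0$ otherwise (switch $e_i$ open); these are the values of $$\xi_i=\frac{b_i\,\boldsymbol\nu_{e_i}^\top\boldsymbol B_r^{-1}\boldsymbol\nu_{e_i}}{1+b_i\,\boldsymbol\nu_{e_i}^\top\boldsymbol B_r^{-1}\boldsymbol\nu_{e_i}}$$ in the limit $b_i\to\infty$ and at $b_i=0$, respectively. Let $$\boldsymbol B_m^{-1}=\lim_{b_i\to\infty,\ i\in S}\Big(\boldsymbol B_r+\sum_{i\in S}b_i\boldsymbol\nu_{e_i}\boldsymbol\nu_{e_i}^\top\Big)^{-1}$$ be the inverse grounded Laplacian for this switch setting. Then $$\boldsymbol B_m^{-1}=\boldsymbol B_r^{-1}-\boldsymbol B_r^{-1}\boldsymbol U\,\boldsymbol\Xi\,\big(\boldsymbol K_d+(\boldsymbol K-\boldsymbol K_d)\boldsymbol\Xi\big)^{-1}\boldsymbol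 U^\top\boldsymbol B_r^{-1},$$ and for every branch $a\notin\{e_1,\dots,e_M\}$ the power transfer distribution factors of the modified grid are $$PTDF^{(m)}_{a,i}=b_a\,\boldsymbol\nu_a^\top\boldsymbol B_m^{-1}\boldsymbol u_i ,$$ where $\boldsymbol u_i$ is here the standard basis vector of $\mathbb R^{N_n-1}$ belonging to the non-slack bus $i$.
   Context: A grid is a finite graph with buses (nodes) $1,\dots,N_n$ and branches (edges) $1,\dots,N_e$, each branch joining two distinct buses (parallel branches allowed) and carrying a fixed orientation. One bus is chosen as slack bus. The grounded node-edge incidence matrix $\boldsymbol E$ has size $(N_n-1)\times N_e$: $E_{n,e}=+1$ if branch $e$ starts at bus $n$, $-1$ if it ends at $n$, $0$ otherwise, with the row of the slack bus removed. For a branch $e$, $\boldsymbol\nu_e$ is the $e$-th column of $\boldsymbol E$. The switches $e_1,\dots,e_M$ are distinct branches included as columns of $\boldsymbol E$; an ideal switch $e_i$ has susceptance $b_i=0$ when open and $b_i\to\infty$ when closed. All other branches $e$ have susceptance $b_e>0$. Let $\mathfrak B_r$ be the diagonal matrix with entries $b_e$ for $e\notin\{e_1,\dots,e_M\}$ and $0$ for the switches. The grounded Laplacian with all switches open is $\boldsymbol B_r=\boldsymbol E\,\mathfrak B_r\boldsymbol E^\top$; connectedness with all switches open means that the graph formed by the non-switch branches is connected, so that $\boldsymbol B_r$ is invertible. The symbol $\boldsymbol B_m^{-1}$ denotes the stated entrywise limit, all $b_i$ with $i\in S$ tending to $+\infty$ jointly; it is notation and not the inverse of a matrix in general. The power transfer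 distribution factor $PTDF^{(m)}_{a,i}$ is the coefficient of the power injection at bus $i$ in the linear expression for the flow on branch $a$ in the grid with the given switch setting.
   Formalization: The formula for B_m^{-1} is claimed only when the closed switches contain no loop; otherwise (e.g. two parallel closed switches) K_d+(K-K_d)Ξ is singular and its inverse undefined. The limit and the PTDF identity are proved for every switch setting. *)

theory Defs
  imports "HOL-Analysis.Analysis"
begin

text \<open>
  Buses are indexed by \<open>'v\<close>, branches by \<open>'e\<close>, switches by \<open>'m\<close>, and the rows of grounded
  matrices by \<open>'n\<close>; \<open>row_bus\<close> enumerates the non-slack buses. A branch \<open>e\<close> is oriented from
  \<open>src G e\<close> to \<open>dst G e\<close>. The values of \<open>suscept\<close> on switches are never used.
\<close>

record ('v, 'e, 'm, 'n) grid =
  src :: "'e \<Rightarrow> 'v"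
  dst :: "'e \<Rightarrow> 'v"
  slack :: 'v
  row_bus :: "'n \<Rightarrow> 'v"
  switch :: "'m \<Rightarrow> 'e"
  suscept :: "'e \<Rightarrow> real"

definition valid_grid :: "('v, 'e, 'm, 'n) grid \<Rightarrow> bool" where
  "valid_grid G \<longleftrightarrow>
     (\<forall>e. src G e \<noteq> dst G e) \<and>
     bij_betw (row_bus G) UNIV (UNIV - {slack G}) \<and>
     inj (switch G) \<and>
     (\<forall>e. e \<notin> range (switch G) \<longrightarrow> suscept G e > 0)"

definition adjacency :: "('v, 'e, 'm, 'n) grid \<Rightarrow> 'e set \<Rightarrow> ('v \<times> 'v) set" where
  "adjacency G A = {(x, y). \<exists>e\<in>A. (src G e = x \<and> dst G e = y) \<or> (src G e = y \<and> dst G e = x)}"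

definition connected_all_open :: "('v, 'e, 'm, 'n) grid \<Rightarrow> bool" where
  "connected_all_open G \<longleftrightarrow> (\<forall>x y. (x, y) \<in> (adjacency G (- range (switch G)))\<^sup>*)"

text \<open>
  The closed switches, as branches of a multigraph, contain no cycle (two parallel closed switches
  count as a cycle): removing any one of them disconnects its end buses from each other within the
  graph formed by the closed switches.
\<close>

definition no_closed_loop :: "('v, 'e, 'm, 'n) grid \<Rightarrow> 'm set \<Rightarrow> bool" where
  "no_closed_loop G S \<longleftrightarrow>
     (\<forall>i\<in>S. (src G (switch G i), dst G (switch G i)) \<notin> (adjacency G (switch G ` (S - {i})))\<^sup>*)"


definition diag :: "('i::finite \<Rightarrow> real) \<Rightarrow> real^'i^'i" where
  "diag d = (\<chi> i j. if i = j then d i else 0)"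

definition outer :: "real^'i::finite \<Rightarrow> real^'i^'i" where
  "outer v = (\<chi> i j. v $ i * v $ j)"

definition incidence :: "('v, 'e::finite, 'm, 'n::finite) grid \<Rightarrow> real^'e^'n" where
  "incidence G = (\<chi> n e. if src G e = row_bus G n then 1
                         else if dst G e = row_bus G n then -1 else 0)"

definition nu :: "('v, 'e::finite, 'm, 'n::finite) grid \<Rightarrow> 'e \<Rightarrow> real^'n" where
  "nu G e = column e (incidence G)"

definition B_r :: "('v, 'e::finite, 'm, 'n::finite) grid \<Rightarrow> real^'n^'n" where
  "B_r G = incidence G ** diag (\<lambda>e. if e \<in> range (switch G) then 0 else suscept G e)
             ** transpose (incidence G)"

definition U :: "('v, 'e::finite, 'm::finite, 'n::finite) grid \<Rightarrow> real^'m^'n" where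
  "U G = (\<chi> n i. nu G (switch G i) $ n)"

definition K :: "('v, 'e::finite, 'm::finite, 'n::finite) grid \<Rightarrow> real^'m^'m" where
  "K G = transpose (U G) ** matrix_inv (B_r G) ** U G"

definition K_d :: "('v, 'e::finite, 'm::finite, 'n::finite) grid \<Rightarrow> real^'m^'m" where
  "K_d G = diag (\<lambda>i. K G $ i $ i)"

definition xi :: "('v, 'e::finite, 'm::finite, 'n::finite) grid \<Rightarrow> 'm \<Rightarrow> real \<Rightarrow> real" where
  "xi G i t = (let q = nu G (switch G i) \<bullet> (matrix_inv (B_r G) *v nu G (switch G i))
               in t * q / (1 + t * q))"

definition Xi :: "'m::finite set \<Rightarrow> real^'m^'m" where
  "Xi S = diag (\<lambda>i. if i \<in> S then 1 else 0)"


text \<open>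
  The filter on \<open>t :: 'm \<Rightarrow> real\<close> of all \<open>t i\<close> with \<open>i \<in> S\<close> tending to infinity jointly and
  independently of each other.
\<close>

definition closing :: "'m set \<Rightarrow> ('m \<Rightarrow> real) filter" where
  "closing S = (INF i\<in>S. filtercomap (\<lambda>t. t i) at_top)"

definition B_finite ::
    "('v, 'e::finite, 'm::finite, 'n::finite) grid \<Rightarrow> 'm set \<Rightarrow> ('m \<Rightarrow> real) \<Rightarrow> real^'n^'n" where
  "B_finite G S t = B_r G + (\<Sum>i\<in>S. t i *\<^sub>R outer (nu G (switch G i)))"

definition B_m_inv ::
    "('v, 'e::finite, 'm::finite, 'n::finite) grid \<Rightarrow> 'm set \<Rightarrow> real^'n^'n" where
  "B_m_inv G S = Lim (closing S) (\<lambda>t. matrix_inv (B_finite G S t))"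


text \<open>
  Linear (DC) power flow for branch susceptances \<open>\<beta>\<close> and injections \<open>p\<close> at the non-slack buses;
  the slack bus has voltage angle zero and balances the injections.
\<close>

definition dc_power_flow ::
    "('v, 'e::finite, 'm, 'n::finite) grid \<Rightarrow> ('e \<Rightarrow> real) \<Rightarrow> real^'n \<Rightarrow>
     ('v \<Rightarrow> real) \<Rightarrow> ('e \<Rightarrow> real) \<Rightarrow> bool" where
  "dc_power_flow G \<beta> p \<theta> f \<longleftrightarrow>
     \<theta> (slack G) = 0 \<and>
     (\<forall>e. f e = \<beta> e * (\<theta> (src G e) - \<theta> (dst G e))) \<and>
     (\<forall>n. (\<Sum>e | src G e = row_bus G n. f e) - (\<Sum>e | dst G e = row_bus G n. f e) = p $ n)"

definition branch_flow ::
    "('v, 'e::finite, 'm, 'n::finite) grid \<Rightarrow> ('e \<Rightarrow> real) \<Rightarrow> real^'n \<Rightarrow> 'e \<Rightarrow> real" where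
  "branch_flow G \<beta> p a = (THE x. \<exists>\<theta> f. dc_power_flow G \<beta> p \<theta> f \<and> f a = x)"

definition setting_suscept ::
    "('v, 'e, 'm, 'n) grid \<Rightarrow> 'm set \<Rightarrow> ('m \<Rightarrow> real) \<Rightarrow> 'e \<Rightarrow> real" where
  "setting_suscept G S t e =
     (if e \<in> range (switch G)
      then (if inv (switch G) e \<in> S then t (inv (switch G) e) else 0)
      else suscept G e)"

text \<open>Closed switches are ideal: the flow is the limit of infinite susceptance.\<close>

definition setting_flow ::
    "('v, 'e::finite, 'm, 'n::finite) grid \<Rightarrow> 'm set \<Rightarrow> real^'n \<Rightarrow> 'e \<Rightarrow> real" where
  "setting_flow G S p a = Lim (closing S) (\<lambda>t. branch_flow G (setting_suscept G S t) p a)"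

definition PTDF ::
    "('v, 'e::finite, 'm, 'n::finite) grid \<Rightarrow> 'm set \<Rightarrow> 'e \<Rightarrow> 'n \<Rightarrow> real" where
  "PTDF G S a = (THE c. \<forall>p. setting_flow G S p a = (\<Sum>i\<in>UNIV. c i * p $ i))"

end

theory Submission
  imports Defs
begin

text \<open>
  For an injection \<open>p\<close>, the solution of the grid with finite susceptances on the closed switches
  converges to the unique \<open>w\<close> with \<open>\<nu>\<^sub>i \<bullet> w = 0\<close> for all closed switches and
  \<open>p - B\<^sub>r w\<close> in the span of their \<open>\<nu>\<^sub>i\<close>. The closed formula is verified
  by checking these two properties. The matrix inverted in the formula is
  nonsingular exactly when the \<open>\<nu>\<^sub>i\<close> of the closed switches are linearly independent,
  that is, when these switches form a forest.
\<close>

section \<open>Positive definite matrices\<close>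

lemma matrix_inv_mul:
  assumes "invertible (A :: 'a::semiring_1^'n^'m)"
  shows "A ** matrix_inv A = mat 1" "matrix_inv A ** A = mat 1"
  using someI_ex[OF assms[unfolded invertible_def]] by (simp_all add: matrix_inv_def)

lemma matrix_inv_vector_mul:
  assumes "invertible (A :: real^'n^'n)"
  shows "A *v (matrix_inv A *v x) = x" "matrix_inv A *v (A *v x) = x"
  by (simp_all add: matrix_vector_mul_assoc matrix_inv_mul[OF assms])

lemma invertible_iff_ker:
  "invertible (A :: real^'n^'n) \<longleftrightarrow> (\<forall>x. A *v x = 0 \<longrightarrow> x = 0)"
  by (metis invertible_left_inverse matrix_left_invertible_ker)

definition pos_def :: "real^'n^'n \<Rightarrow> bool" where
  "pos_def A \<longleftrightarrow> (\<forall>x. x \<noteq> 0 \<longrightarrow> x \<bullet> (A *v x) > 0)"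

lemma pos_defD: "pos_def A \<Longrightarrow> x \<noteq> 0 \<Longrightarrow> x \<bullet> (A *v x) > 0"
  by (simp add: pos_def_def)

lemma pos_def_invertible: "pos_def A \<Longrightarrow> invertible A"
  unfolding invertible_iff_ker by (metis inner_zero_right less_irrefl pos_defD)

text \<open>Substituting \<open>x = A *v w\<close> turns the form of the inverse at \<open>x\<close>
  into the form of \<open>A\<close> at the nonzero vector \<open>w\<close>.\<close>

lemma pos_def_matrix_inv:
  assumes "pos_def A"
  shows "pos_def (matrix_inv A)"
  unfolding pos_def_def
proof (intro allI impI)
  fix x :: "real^'a" assume "x \<noteq> 0"
  define w where "w = matrix_inv A *v x"
  have x: "x = A *v w"
    by (simp add: w_def matrix_inv_vector_mul pos_def_invertible[OF assms])
  with \<open>x \<noteq> 0\<close> have "w \<noteq> 0" by auto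
  then show "x \<bullet> (matrix_inv A *v x) > 0"
    using pos_defD[OF assms, of w] by (metis inner_commute w_def x)
qed

text \<open>The constant is the minimum of the form on the unit sphere, attained by compactness;
  homogeneity of degree two carries the bound to all vectors.\<close>

lemma pos_def_coercive:
  assumes "pos_def (A :: real^'n^'n)"
  obtains k where "k > 0" "\<And>x. k * (norm x)\<^sup>2 \<le> x \<bullet> (A *v x)"
proof -
  have "continuous_on (sphere 0 1) (\<lambda>x. x \<bullet> (A *v x))"
    by (intro continuous_intros linear_continuous_on linear_conv_bounded_linear[THEN iffD1]
        matrix_vector_mul_linear)
  moreover have "sphere (0::real^'n) 1 \<noteq> {}" by simp
  ultimately obtain u where u: "u \<in> sphere 0 1"
    and min: "\<And>y. y \<in> sphere 0 1 \<Longrightarrow> u \<bullet> (A *v u) \<le> y \<bullet> (A *v y)"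
    using continuous_attains_inf[OF compact_sphere, of 0 1 "\<lambda>x. x \<bullet> (A *v x)"] by blast
  from u have "u \<noteq> 0" by auto
  show thesis
  proof
    show "u \<bullet> (A *v u) > 0" by (rule pos_defD[OF assms \<open>u \<noteq> 0\<close>])
    fix x :: "real^'n"
    show "u \<bullet> (A *v u) * (norm x)\<^sup>2 \<le> x \<bullet> (A *v x)"
    proof (cases "x = 0")
      case False
      have "u \<bullet> (A *v u) \<le> (x /\<^sub>R norm x) \<bullet> (A *v (x /\<^sub>R norm x))"
        by (rule min) (use False in simp)
      also have "\<dots> = (x \<bullet> (A *v x)) / (norm x)\<^sup>2"
        by (simp add: matrix_vector_mult_scaleR power2_eq_square divide_simps)
      finally show ?thesis using False by (simp add: field_simps)
    qed simp
  qed
qed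

section \<open>Rank-one penalty terms acting on vectors\<close>

lemma sum_matrix_vector_mult: "(\<Sum>i\<in>S. f i) *v x = (\<Sum>i\<in>S. f i *v (x :: real^'n))"
  by (induction S rule: infinite_finite_induct) (simp_all add: matrix_vector_mult_add_rdistrib)

lemma diag_mult: "diag d *v x = (\<chi> i. d i * x $ i)"
  by (simp add: diag_def vec_eq_iff matrix_vector_mult_def if_distrib[of "\<lambda>c. c * _"] cong: if_cong)

lemma outer_mult: "outer v *v x = (v \<bullet> x) *\<^sub>R v"
  by (simp add: vec_eq_iff outer_def matrix_vector_mult_def inner_vec_def sum_distrib_left mult_ac)

lemma scaleR_matrix_vector_mult: "(c *\<^sub>R A) *v x = c *\<^sub>R (A *v (x :: real^'n))"
  by (simp add: scaleR_matrix_vector_assoc)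

lemma penalty_mult:
  "(A + (\<Sum>i\<in>S. t i *\<^sub>R outer (v i))) *v x = A *v x + (\<Sum>i\<in>S. (t i * (v i \<bullet> x)) *\<^sub>R v i)"
  by (simp add: matrix_vector_mult_add_rdistrib sum_matrix_vector_mult outer_mult
      scaleR_matrix_vector_mult)

lemma pos_def_penalty:
  assumes "pos_def A" and "\<And>i. i \<in> S \<Longrightarrow> t i \<ge> 0"
  shows "pos_def (A + (\<Sum>i\<in>S. t i *\<^sub>R outer (v i)))"
  unfolding pos_def_def
proof (intro allI impI)
  fix x :: "real^'a" assume "x \<noteq> 0"
  have "0 \<le> (\<Sum>i\<in>S. t i * (v i \<bullet> x)\<^sup>2)"
    by (intro sum_nonneg mult_nonneg_nonneg assms) auto
  then show "x \<bullet> ((A + (\<Sum>i\<in>S. t i *\<^sub>R outer (v i))) *v x) > 0"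
    using pos_defD[OF assms(1) \<open>x \<noteq> 0\<close>]
    by (simp add: penalty_mult inner_add_right inner_sum_right inner_commute[of x]
        power2_eq_square mult.assoc)
qed

section \<open>The limit of infinite susceptances\<close>

text \<open>The reachable right-hand sides form a subspace \<open>V\<close>. A vector
  \<open>y\<close> orthogonal to \<open>V\<close> satisfies the constraints itself, so
  \<open>A *v y\<close> lies in \<open>V\<close> and positivity forces \<open>y = 0\<close>.\<close>

lemma constrained_solution_exists:
  fixes A :: "real^'n^'n" and v :: "'m::finite \<Rightarrow> real^'n"
  assumes "pos_def A"
  obtains w c where "\<And>i. i \<in> S \<Longrightarrow> v i \<bullet> w = 0" "p = A *v w + (\<Sum>i\<in>S. c i *\<^sub>R v i)"
proof -
  define V where "V = {A *v w + (\<Sum>i\<in>S. c i *\<^sub>R v i) | w c. \<forall>i\<in>S. v i \<bullet> w = 0}"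
  have V: "A *v w + (\<Sum>i\<in>S. c i *\<^sub>R v i) \<in> V" if "\<forall>i\<in>S. v i \<bullet> w = 0" for w c
    using that by (auto simp: V_def)
  have "subspace V"
  proof (rule subspaceI)
    show "0 \<in> V" using V[of 0 "\<lambda>_. 0"] by simp
  next
    fix x y assume "x \<in> V" "y \<in> V"
    then obtain w c w' c' where "\<forall>i\<in>S. v i \<bullet> w = 0" "\<forall>i\<in>S. v i \<bullet> w' = 0"
      and "x = A *v w + (\<Sum>i\<in>S. c i *\<^sub>R v i)" "y = A *v w' + (\<Sum>i\<in>S. c' i *\<^sub>R v i)"
      by (auto simp: V_def)
    then show "x + y \<in> V" using V[of "w + w'" "\<lambda>i. c i + c' i"]
      by (simp add: inner_add_right matrix_vector_right_distrib scaleR_add_left sum.distrib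
          algebra_simps)
  next
    fix x and r :: real assume "x \<in> V"
    then obtain w c where "\<forall>i\<in>S. v i \<bullet> w = 0" "x = A *v w + (\<Sum>i\<in>S. c i *\<^sub>R v i)"
      by (auto simp: V_def)
    then show "r *\<^sub>R x \<in> V" using V[of "r *\<^sub>R w" "\<lambda>i. r * c i"]
      by (simp add: matrix_vector_mult_scaleR scaleR_add_right scaleR_sum_right)
  qed
  have "span V = UNIV"
  proof (rule ccontr)
    assume "span V \<noteq> UNIV"
    then obtain y where "y \<noteq> 0" and y: "\<forall>x\<in>span V. y \<bullet> x = 0"
      using span_not_UNIV_orthogonal by blast
    have y0: "y \<bullet> (A *v w + (\<Sum>i\<in>S. c i *\<^sub>R v i)) = 0" if "\<forall>i\<in>S. v i \<bullet> w = 0" for w c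
      using V[OF that] y span_base by blast
    have "v j \<bullet> y = 0" if "j \<in> S" for j
      using y0[of 0 "\<lambda>i. if i = j then 1 else 0"] that
      by (simp add: if_distrib[of "\<lambda>c. c *\<^sub>R _"] inner_commute cong: if_cong)
    then have "y \<bullet> (A *v y) = 0" using y0[of y "\<lambda>_. 0"] by simp
    with pos_defD[OF assms \<open>y \<noteq> 0\<close>] show False by simp
  qed
  then have "p \<in> V" using \<open>subspace V\<close> by (metis UNIV_I span_eq_iff)
  then show thesis using that by (auto simp: V_def)
qed

text \<open>The diagonal path, with all coordinates equal and tending to infinity, refines the
  filter. Properness makes limits unique, so that \<open>Lim\<close> returns the actual
  limit.\<close>

lemma closing_nontrivial: "closing S \<noteq> bot"
proof -
  have "filtermap (\<lambda>s _. s) at_top \<le> closing S"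
    unfolding closing_def le_INF_iff filtermap_le_iff_le_filtercomap filtercomap_filtercomap
    by (simp add: filtermap_le_iff_le_filtercomap[symmetric] filtercomap_ident)
  moreover have "filtermap (\<lambda>s (_::'a). s :: real) at_top \<noteq> bot"
    by (simp add: filtermap_bot_iff)
  ultimately show ?thesis by (auto simp: le_bot)
qed

lemma closing_at_top: "i \<in> S \<Longrightarrow> filterlim (\<lambda>t. t i) at_top (closing S)"
  unfolding closing_def by (erule filterlim_INF') (rule filterlim_filtercomap)

lemma eventually_closing_pos:
  fixes S :: "'m::finite set"
  shows "\<forall>\<^sub>F t in closing S. \<forall>i\<in>S. t i > 0"
  unfolding eventually_ball_finite_distrib[OF finite]
  using closing_at_top[unfolded filterlim_at_top_dense] by (intro ballI) (rule spec)

text \<open>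
  With \<open>d = (A + \<Sum> t\<^sub>i v\<^sub>i v\<^sub>i\<^sup>T)\<^sup>-\<^sup>1 p - w\<close> one has \<open>d \<bullet> A d + \<Sum> t\<^sub>i (v\<^sub>i \<bullet> d)\<^sup>2 = \<Sum> c\<^sub>i (v\<^sub>i \<bullet> d)\<close>, and completing
  the squares leaves \<open>d \<bullet> A d \<le> \<Sum> c\<^sub>i\<^sup>2 / (4 t\<^sub>i)\<close>.
\<close>

lemma penalty_limit:
  fixes A :: "real^'n^'n" and v :: "'m::finite \<Rightarrow> real^'n"
  assumes A: "pos_def A"
    and w: "\<And>i. i \<in> S \<Longrightarrow> v i \<bullet> w = 0"
    and p: "p = A *v w + (\<Sum>i\<in>S. c i *\<^sub>R v i)"
  shows "((\<lambda>t. matrix_inv (A + (\<Sum>i\<in>S. t i *\<^sub>R outer (v i))) *v p) \<longlongrightarrow> w) (closing S)"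
proof -
  define M where "M = (\<lambda>t. A + (\<Sum>i\<in>S. t i *\<^sub>R outer (v i)))"
  define d where "d = (\<lambda>t. matrix_inv (M t) *v p - w)"
  obtain k where k: "k > 0" "\<And>x. k * (norm x)\<^sup>2 \<le> x \<bullet> (A *v x)"
    using pos_def_coercive[OF A] by blast
  have bound: "(norm (d t))\<^sup>2 \<le> (\<Sum>i\<in>S. (c i)\<^sup>2 / 4 / t i) / k" if t: "\<forall>i\<in>S. t i > 0" for t
  proof -
    have "invertible (M t)"
      unfolding M_def using t by (intro pos_def_invertible pos_def_penalty A) (auto simp: less_imp_le)
    then have "M t *v d t = p - M t *v w"
      by (simp add: d_def matrix_vector_mult_diff_distrib matrix_inv_vector_mul)
    \<comment> \<open>The penalty terms vanish at \<open>w\<close> by the constraints, so only the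
      multiplier part of \<open>p\<close> survives.\<close>
    also have "\<dots> = (\<Sum>i\<in>S. c i *\<^sub>R v i)"
      by (simp add: M_def penalty_mult p w)
    finally have "d t \<bullet> (M t *v d t) = (\<Sum>i\<in>S. c i * (v i \<bullet> d t))"
      by (simp add: inner_sum_right inner_commute)
    then have "d t \<bullet> (A *v d t) = (\<Sum>i\<in>S. c i * (v i \<bullet> d t) - t i * (v i \<bullet> d t)\<^sup>2)"
      by (simp add: M_def penalty_mult inner_add_right inner_sum_right inner_commute[of "d t"]
          power2_eq_square mult.assoc sum_subtractf)
    also have "\<dots> \<le> (\<Sum>i\<in>S. (c i)\<^sup>2 / 4 / t i)"
    proof (rule sum_mono)
      fix i assume "i \<in> S"
      with t have "t i > 0" by simp
      then have "(c i)\<^sup>2 / 4 / t i - (c i * (v i \<bullet> d t) - t i * (v i \<bullet> d t)\<^sup>2)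
          = t i * (v i \<bullet> d t - c i / (2 * t i))\<^sup>2"
        by (simp add: field_simps power2_eq_square)
      also have "\<dots> \<ge> 0" using \<open>t i > 0\<close> by simp
      finally show "c i * (v i \<bullet> d t) - t i * (v i \<bullet> d t)\<^sup>2 \<le> (c i)\<^sup>2 / 4 / t i" by simp
    qed
    finally have "k * (norm (d t))\<^sup>2 \<le> (\<Sum>i\<in>S. (c i)\<^sup>2 / 4 / t i)"
      using k(2)[of "d t"] by linarith
    then show ?thesis using k(1) by (simp add: field_simps)
  qed
  have "((\<lambda>t. \<Sum>i\<in>S. (c i)\<^sup>2 / 4 / t i) \<longlongrightarrow> (\<Sum>i\<in>S. 0)) (closing S)"
    by (intro tendsto_sum real_tendsto_divide_at_top[OF tendsto_const] closing_at_top)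
  then have "((\<lambda>t. (\<Sum>i\<in>S. (c i)\<^sup>2 / 4 / t i) / k) \<longlongrightarrow> 0) (closing S)"
    using tendsto_divide_zero by fastforce
  then have "((\<lambda>t. (norm (d t))\<^sup>2) \<longlongrightarrow> 0) (closing S)"
    by (rule tendsto_sandwich[OF _ _ tendsto_const, rotated 2])
      (use bound in \<open>auto intro!: always_eventually eventually_mono[OF eventually_closing_pos]
        simp del: divide_divide_eq_left\<close>)
  then have "((\<lambda>t. norm (d t)) \<longlongrightarrow> 0) (closing S)"
    using tendsto_real_sqrt[of "\<lambda>t. (norm (d t))\<^sup>2" 0] by simp
  then show ?thesis
    by (simp add: d_def M_def tendsto_norm_zero_iff LIM_zero_iff)
qed

text \<open>Convergence at the standard basis vectors is convergence of every column, hence of the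
  matrix.\<close>

lemma tendsto_matrix_of_vector_mult:
  fixes F :: "'a \<Rightarrow> real^'n^'m"
  assumes "\<And>p. \<exists>w. ((\<lambda>t. F t *v p) \<longlongrightarrow> w) net"
  shows "\<exists>L. (F \<longlongrightarrow> L) net"
proof -
  obtain w where w: "\<And>p. ((\<lambda>t. F t *v p) \<longlongrightarrow> w p) net"
    using assms by metis
  have "(F \<longlongrightarrow> (\<chi> i j. w (axis j 1) $ i)) net"
  proof (intro vec_tendstoI)
    fix i j
    show "((\<lambda>t. F t $ i $ j) \<longlongrightarrow> (\<chi> i j. w (axis j 1) $ i) $ i $ j) net"
      using tendsto_vec_nth[OF w, of "axis j 1" i]
      by (simp add: matrix_vector_mult_basis column_def)
  qed
  then show ?thesis ..
qed

section \<open>Grids\<close>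

text \<open>Turns a grounded vector into a potential on the whole graph, so that path and
  connectivity arguments apply to it.\<close>

definition bus_angle :: "('v, 'e, 'm, 'n) grid \<Rightarrow> real^'n \<Rightarrow> 'v \<Rightarrow> real" where
  "bus_angle G x b = (if b = slack G then 0 else x $ inv (row_bus G) b)"

lemma valid_gridD:
  assumes "valid_grid G"
  shows "src G e \<noteq> dst G e" "inj (row_bus G)" "range (row_bus G) = UNIV - {slack G}"
    "row_bus G n \<noteq> slack G" "inj (switch G)" "e \<notin> range (switch G) \<Longrightarrow> suscept G e > 0"
  using assms by (auto simp: valid_grid_def bij_betw_def)

lemma bus_angle_row_bus: "valid_grid G \<Longrightarrow> bus_angle G x (row_bus G n) = x $ n"
  by (simp add: bus_angle_def valid_gridD inv_f_f)

lemma bus_angle_slack: "bus_angle G x (slack G) = 0"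
  by (simp add: bus_angle_def)

lemma bus_angle_of:
  assumes "valid_grid G" "\<theta> (slack G) = 0"
  shows "bus_angle G (\<chi> n. \<theta> (row_bus G n)) = \<theta>"
proof
  fix b
  show "bus_angle G (\<chi> n. \<theta> (row_bus G n)) b = \<theta> b"
  proof (cases "b = slack G")
    case False
    then have "b \<in> range (row_bus G)" using valid_gridD(3)[OF assms(1)] by simp
    then show ?thesis using False by (simp add: bus_angle_def f_inv_into_f)
  qed (simp add: bus_angle_def assms)
qed

lemma nu_nth: "nu G e $ n = incidence G $ n $ e"
  by (simp add: nu_def column_def)

text \<open>Dropping the slack row costs nothing, as the potential is zero there: the sum over rows
  extends to all buses, and only the two ends of the branch contribute.\<close>

lemma nu_inner:
  fixes G :: "('v::finite, 'e::finite, 'm::finite, 'n::finite) grid"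
  assumes "valid_grid G"
  shows "nu G e \<bullet> x = bus_angle G x (src G e) - bus_angle G x (dst G e)"
proof -
  define h where "h = (\<lambda>b. (if src G e = b then bus_angle G x b else 0)
    - (if dst G e = b then bus_angle G x b else 0))"
  have "nu G e \<bullet> x = (\<Sum>n\<in>UNIV. h (row_bus G n))"
    unfolding inner_vec_def
    by (rule sum.cong)
      (use valid_gridD(1)[OF assms, of e] in
        \<open>auto simp: h_def nu_nth incidence_def bus_angle_row_bus[OF assms]\<close>)
  also have "\<dots> = (\<Sum>b\<in>UNIV - {slack G}. h b)"
    by (rule sum.reindex_bij_betw) (use assms in \<open>simp add: valid_grid_def\<close>)
  also have "\<dots> = (\<Sum>b\<in>UNIV. h b)"
    by (rule sum.mono_neutral_left) (auto simp: h_def bus_angle_slack)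
  also have "\<dots> = bus_angle G x (src G e) - bus_angle G x (dst G e)"
    by (simp add: h_def sum_subtractf)
  finally show ?thesis .
qed

text \<open>The ends of a branch are distinct, so at least one of them is not the slack bus and
  leaves a nonzero entry.\<close>

lemma nu_nonzero:
  fixes G :: "('v::finite, 'e::finite, 'm::finite, 'n::finite) grid"
  assumes "valid_grid G"
  shows "nu G e \<noteq> 0"
proof
  assume "nu G e = 0"
  then have z: "incidence G $ n $ e = 0" for n by (metis nu_nth zero_index)
  have "src G e \<noteq> row_bus G n \<and> dst G e \<noteq> row_bus G n" for n
    using z[of n] by (auto simp: incidence_def split: if_splits)
  then have "src G e \<notin> range (row_bus G)" "dst G e \<notin> range (row_bus G)" by blast+
  then show False using valid_gridD(1)[OF assms, of e] by (simp add: valid_gridD(3)[OF assms])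
qed

lemma laplacian_mult:
  "(incidence G ** diag \<beta> ** transpose (incidence G)) *v x
    = (\<Sum>e\<in>UNIV. (\<beta> e * (nu G e \<bullet> x)) *\<^sub>R nu G e)"
proof -
  have "(transpose (incidence G) *v x) $ e = nu G e \<bullet> x" for e
    by (simp add: matrix_vector_mult_def transpose_def inner_vec_def nu_nth)
  then show ?thesis
    by (simp add: matrix_vector_mul_assoc[symmetric] diag_mult matrix_mult_sum[of "incidence G"] nu_def
        scalar_mult_eq_scaleR del: matrix_vector_mul_assoc)
qed

lemma B_r_mult:
  "B_r G *v x = (\<Sum>e\<in>UNIV - range (switch G). (suscept G e * (nu G e \<bullet> x)) *\<^sub>R nu G e)"
  unfolding B_r_def laplacian_mult by (rule sum.mono_neutral_cong_right) auto

lemma connected_invariant: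
  assumes "(x, y) \<in> (adjacency G A)\<^sup>*" and "\<And>e. e \<in> A \<Longrightarrow> f (src G e) = f (dst G e)"
  shows "f x = f y"
  using assms(1) by induction (auto simp: adjacency_def assms(2))

text \<open>The form is a weighted sum of squared angle differences. If it vanishes, the potential
  is constant along non-switch branches, and connectedness makes it equal to its slack value
  zero.\<close>

lemma pos_def_B_r:
  fixes G :: "('v::finite, 'e::finite, 'm::finite, 'n::finite) grid"
  assumes G: "valid_grid G" and conn: "connected_all_open G"
  shows "pos_def (B_r G)"
  unfolding pos_def_def
proof (intro allI impI)
  fix x :: "real^'n" assume "x \<noteq> 0"
  let ?R = "UNIV - range (switch G)"
  have q: "x \<bullet> (B_r G *v x) = (\<Sum>e\<in>?R. suscept G e * (nu G e \<bullet> x)\<^sup>2)"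
    by (simp add: B_r_mult inner_sum_right inner_commute[of x] power2_eq_square mult.assoc)
  have nonneg: "suscept G e * (nu G e \<bullet> x)\<^sup>2 \<ge> 0" if "e \<in> ?R" for e
    using valid_gridD(6)[OF G] that by (simp add: less_imp_le)
  have "x \<bullet> (B_r G *v x) \<noteq> 0"
  proof
    assume "x \<bullet> (B_r G *v x) = 0"
    then have "\<forall>e\<in>?R. suscept G e * (nu G e \<bullet> x)\<^sup>2 = 0"
      unfolding q by (subst (asm) sum_nonneg_eq_0_iff) (use nonneg in auto)
    then have "nu G e \<bullet> x = 0" if "e \<notin> range (switch G)" for e
      using valid_gridD(6)[OF G that] that
      by (metis DiffI UNIV_I less_irrefl mult_eq_0_iff zero_eq_power2)
    then have edge: "bus_angle G x (src G e) = bus_angle G x (dst G e)"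
      if "e \<in> - range (switch G)" for e
      using that by (simp add: nu_inner[OF G])
    have "x $ n = 0" for n
      using connected_invariant[where f = "bus_angle G x", OF _ edge] conn
      by (metis G bus_angle_row_bus bus_angle_slack connected_all_open_def)
    then have "x = 0" by (simp add: vec_eq_iff)
    with \<open>x \<noteq> 0\<close> show False by simp
  qed
  moreover have "x \<bullet> (B_r G *v x) \<ge> 0" unfolding q by (intro sum_nonneg nonneg)
  ultimately show "x \<bullet> (B_r G *v x) > 0" by simp
qed

section \<open>Loops of closed switches\<close>

text \<open>Coefficients are indexed by \<open>S\<close> rather than by the image, since parallel
  switches may share an incidence vector.\<close>

lemma span_image_sum:
  fixes v :: "'i \<Rightarrow> 'a::real_vector"
  assumes "finite S" and "x \<in> span (v ` S)"
  obtains c where "x = (\<Sum>i\<in>S. c i *\<^sub>R v i)"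
proof -
  have "\<exists>c. x = (\<Sum>i\<in>S. c i *\<^sub>R v i)"
    using assms(2)
  proof (induction rule: span_induct_alt)
    case base
    show ?case by (rule exI[of _ "\<lambda>_. 0"]) simp
  next
    case (step r y z)
    then obtain j c where "j \<in> S" "y = v j" "z = (\<Sum>i\<in>S. c i *\<^sub>R v i)" by auto
    then have "r *\<^sub>R y + z = (\<Sum>i\<in>S. ((if i = j then r else 0) + c i) *\<^sub>R v i)"
      using assms(1)
      by (simp add: scaleR_add_left sum.distrib if_distrib[of "\<lambda>c. c *\<^sub>R _"] cong: if_cong)
    then show ?case by (rule exI[of _ "\<lambda>i. (if i = j then r else 0) + c i"])
  qed
  then show thesis using that by blast
qed

text \<open>Telescoping along the path: each traversed branch contributes its incidence vector up to
  sign.\<close>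

lemma nu_in_span_path:
  fixes G :: "('v, 'e::finite, 'm, 'n::finite) grid"
  assumes "valid_grid G" and "(src G e, dst G e) \<in> (adjacency G A)\<^sup>*"
  shows "nu G e \<in> span (nu G ` A)"
proof -
  \<comment> \<open>\<open>chi b\<close> is the basis vector of \<open>b\<close>, and zero when
    \<open>b\<close> is the slack bus.\<close>
  define chi where "chi = (\<lambda>b. (\<chi> n. if b = row_bus G n then 1 else 0) :: real^'n)"
  have nu: "nu G f = chi (src G f) - chi (dst G f)" for f
    using valid_gridD(1)[OF assms(1), of f]
    by (auto simp: vec_eq_iff nu_nth incidence_def chi_def)
  have "chi x - chi y \<in> span (nu G ` A)" if "(x, y) \<in> (adjacency G A)\<^sup>*" for x y
    using that
  proof induction
    case base
    show ?case by (simp add: span_zero)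
  next
    case (step y z)
    from step(2) obtain f where "f \<in> A"
      and f: "nu G f = chi y - chi z \<or> - nu G f = chi y - chi z"
      by (auto simp: adjacency_def nu)
    then have "chi y - chi z \<in> span (nu G ` A)"
      by (metis imageI span_base span_neg)
    from span_add[OF step(3) this] show ?case by simp
  qed
  from this[OF assms(2)] show ?thesis by (simp add: nu)
qed

text \<open>Without a loop, pairing a linear relation with the indicator of a component left after
  removing switch \<open>i\<close> isolates \<open>c i\<close>. Conversely, a path through other
  closed switches puts the column of \<open>i\<close> in their span, which is a nontrivial
  relation.\<close>

lemma no_closed_loop_iff_independent:
  fixes G :: "('v::finite, 'e::finite, 'm::finite, 'n::finite) grid"
  assumes G: "valid_grid G"
  shows "no_closed_loop G S \<longleftrightarrow>
    (\<forall>c. (\<Sum>i\<in>S. c i *\<^sub>R nu G (switch G i)) = 0 \<longrightarrow> (\<forall>i\<in>S. c i = 0))"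
    (is "_ \<longleftrightarrow> ?indep")
proof
  assume loop: "no_closed_loop G S"
  show ?indep
  proof (intro allI impI ballI)
    fix c i assume c: "(\<Sum>i\<in>S. c i *\<^sub>R nu G (switch G i)) = 0" and "i \<in> S"
    let ?E = "adjacency G (switch G ` (S - {i}))"
    let ?s = "src G (switch G i)" and ?d = "dst G (switch G i)"
    \<comment> \<open>indicator of the component of one end of switch \<open>i\<close> in the graph of the other closed
      switches, grounded at the slack bus\<close>
    define f where "f = (\<lambda>b. if (?s, b) \<in> ?E\<^sup>* then 1 else 0 :: real)"
    define x where "x = (\<chi> n. f (row_bus G n) - f (slack G))"
    have nu_x: "nu G e \<bullet> x = f (src G e) - f (dst G e)" for e
      using bus_angle_of[OF G, of "\<lambda>b. f b - f (slack G)"]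
      by (simp add: nu_inner[OF G] x_def)
    have "nu G (switch G j) \<bullet> x = 0" if "j \<in> S - {i}" for j
    proof -
      have "(src G (switch G j), dst G (switch G j)) \<in> ?E"
        "(dst G (switch G j), src G (switch G j)) \<in> ?E"
        using that by (auto simp: adjacency_def)
      then have "f (src G (switch G j)) = f (dst G (switch G j))"
        unfolding f_def by (meson rtrancl.rtrancl_into_rtrancl)
      then show ?thesis by (simp add: nu_x)
    qed
    moreover have "nu G (switch G i) \<bullet> x = 1"
      using loop \<open>i \<in> S\<close> by (simp add: nu_x f_def no_closed_loop_def)
    ultimately have "(\<Sum>j\<in>S. c j *\<^sub>R nu G (switch G j)) \<bullet> x = c i"
      using \<open>i \<in> S\<close> by (simp add: inner_add_left inner_sum_left sum.remove)
    with c show "c i = 0" by simp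
  qed
next
  assume indep: ?indep
  show "no_closed_loop G S"
    unfolding no_closed_loop_def
  proof (intro ballI notI)
    fix i assume "i \<in> S"
      and "(src G (switch G i), dst G (switch G i)) \<in> (adjacency G (switch G ` (S - {i})))\<^sup>*"
    then have "nu G (switch G i) \<in> span ((\<lambda>j. nu G (switch G j)) ` (S - {i}))"
      using nu_in_span_path[OF G] by (metis (no_types) image_image)
    then obtain c where "nu G (switch G i) = (\<Sum>j\<in>S - {i}. c j *\<^sub>R nu G (switch G j))"
      by (rule span_image_sum[OF finite])
    then have "(\<Sum>j\<in>S. (if j = i then -1 else c j) *\<^sub>R nu G (switch G j)) = 0"
      using \<open>i \<in> S\<close> by (simp add: sum.remove)
    with indep \<open>i \<in> S\<close> show False by fastforce
  qed
qed


section \<open>The inverse Laplacian of a switch setting\<close>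

text \<open>Identifies the penalized matrix with the grounded Laplacian under
  \<open>setting_suscept\<close>, which links the matrix limit to the power flow.\<close>

lemma B_finite_mult_switch:
  fixes G :: "('v::finite, 'e::finite, 'm::finite, 'n::finite) grid"
  assumes G: "valid_grid G"
  shows "B_finite G S t *v x =
    (\<Sum>e\<in>UNIV. (setting_suscept G S t e * (nu G e \<bullet> x)) *\<^sub>R nu G e)"
proof -
  let ?g = "\<lambda>e. (setting_suscept G S t e * (nu G e \<bullet> x)) *\<^sub>R nu G e"
  have inj: "inj (switch G)" by (rule valid_gridD[OF G])
  have "(\<Sum>e\<in>UNIV. ?g e) = (\<Sum>e\<in>UNIV - range (switch G). ?g e) + (\<Sum>e\<in>range (switch G). ?g e)"
    by (rule sum.subset_diff) auto
  also have "(\<Sum>e\<in>UNIV - range (switch G). ?g e) = B_r G *v x"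
    unfolding B_r_mult by (rule sum.cong) (auto simp: setting_suscept_def)
  also have "(\<Sum>e\<in>range (switch G). ?g e) = (\<Sum>i\<in>UNIV. ?g (switch G i))"
    by (simp add: sum.reindex[OF inj])
  also have "\<dots> = (\<Sum>i\<in>S. (t i * (nu G (switch G i) \<bullet> x)) *\<^sub>R nu G (switch G i))"
    by (rule sum.mono_neutral_cong_right) (auto simp: setting_suscept_def inv_f_f[OF inj])
  finally show ?thesis by (simp add: B_finite_def penalty_mult)
qed

lemma invertible_B_finite:
  assumes "pos_def (B_r G)" and "\<forall>i\<in>S. t i > 0"
  shows "invertible (B_finite G S t)"
  unfolding B_finite_def using assms
  by (intro pos_def_invertible pos_def_penalty) (auto simp: less_imp_le)

text \<open>\<open>B_m_inv\<close> is defined by \<open>Lim\<close>, which is informative only once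
  convergence is known. Convergence is obtained vector by vector from the constrained
  solution.\<close>

lemma B_finite_inv_limit:
  fixes G :: "('v, 'e::finite, 'm::finite, 'n::finite) grid"
  assumes "pos_def (B_r G)"
  shows "((\<lambda>t. matrix_inv (B_finite G S t)) \<longlongrightarrow> B_m_inv G S) (closing S)"
proof -
  have "\<exists>L. ((\<lambda>t. matrix_inv (B_finite G S t)) \<longlongrightarrow> L) (closing S)"
  proof (rule tendsto_matrix_of_vector_mult)
    fix p
    obtain w c where "\<And>i. i \<in> S \<Longrightarrow> nu G (switch G i) \<bullet> w = 0"
      and "p = B_r G *v w + (\<Sum>i\<in>S. c i *\<^sub>R nu G (switch G i))"
      by (rule constrained_solution_exists[OF assms, where S = S and p = p
            and v = "\<lambda>i. nu G (switch G i)"]) blast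
    from penalty_limit[OF assms this, folded B_finite_def]
    show "\<exists>w. ((\<lambda>t. matrix_inv (B_finite G S t) *v p) \<longlongrightarrow> w) (closing S)" ..
  qed
  then obtain L where L: "((\<lambda>t. matrix_inv (B_finite G S t)) \<longlongrightarrow> L) (closing S)" ..
  from L tendsto_Lim[OF closing_nontrivial L] show ?thesis
    by (simp add: B_m_inv_def)
qed

lemma tendsto_matrix_vector_mult:
  fixes F :: "'a \<Rightarrow> real^'n^'m"
  assumes "(F \<longlongrightarrow> L) net"
  shows "((\<lambda>t. F t *v p) \<longlongrightarrow> L *v p) net"
  unfolding matrix_vector_mult_def by (intro tendsto_intros assms)

text \<open>Both sides are limits of the same function along a proper filter. The closed formula is
  checked through this criterion.\<close>

lemma B_m_inv_mult_eqI:
  assumes "pos_def (B_r G)"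
    and "\<And>i. i \<in> S \<Longrightarrow> nu G (switch G i) \<bullet> w = 0"
    and "p = B_r G *v w + (\<Sum>i\<in>S. c i *\<^sub>R nu G (switch G i))"
  shows "B_m_inv G S *v p = w"
  by (rule tendsto_unique[OF closing_nontrivial
        tendsto_matrix_vector_mult[OF B_finite_inv_limit[OF assms(1)]]
        penalty_limit[OF assms, folded B_finite_def]])

section \<open>The coupling matrix and the closed formula\<close>

lemma transpose_U_mult: "(transpose (U G) *v y) $ i = nu G (switch G i) \<bullet> y"
  by (simp add: matrix_vector_mult_def transpose_def U_def inner_vec_def)

lemma U_mult: "U G *v c = (\<Sum>i\<in>UNIV. c $ i *\<^sub>R nu G (switch G i))"
  by (simp add: vec_eq_iff matrix_vector_mult_def U_def mult.commute)

lemma K_mult: "K G *v c = transpose (U G) *v (matrix_inv (B_r G) *v (U G *v c))"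
  by (simp add: K_def matrix_vector_mul_assoc matrix_mul_assoc)

lemma K_nth:
  "K G $ i $ i = nu G (switch G i) \<bullet> (matrix_inv (B_r G) *v nu G (switch G i))"
proof -
  have "U G *v axis i 1 = nu G (switch G i)"
    unfolding matrix_vector_mult_basis by (simp add: vec_eq_iff column_def U_def)
  moreover have "K G $ i $ i = (K G *v axis i 1) $ i"
    unfolding matrix_vector_mult_basis by (simp add: column_def)
  ultimately show ?thesis by (simp only: K_mult transpose_U_mult)
qed

text \<open>Regrouped, the matrix is \<open>K G ** Xi S + K_d G ** (mat 1 - Xi S)\<close>, so the
  diagonal part survives only in rows outside \<open>S\<close>.\<close>

lemma coupling_matrix_mult:
  "((K_d G + (K G - K_d G) ** Xi S) *v c) $ i
    = (if i \<in> S then 0 else K G $ i $ i * c $ i) + (K G *v (Xi S *v c)) $ i"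
proof -
  have "(K_d G + (K G - K_d G) ** Xi S) *v c
      = K_d G *v c + (K G *v (Xi S *v c) - K_d G *v (Xi S *v c))"
    by (simp add: matrix_vector_mult_add_rdistrib matrix_vector_mult_diff_rdistrib
        matrix_vector_mul_assoc[symmetric] del: matrix_vector_mul_assoc)
  then show ?thesis by (simp add: K_d_def Xi_def diag_mult)
qed

lemma U_Xi_mult: "U G *v (Xi S *v c) = (\<Sum>i\<in>S. c $ i *\<^sub>R nu G (switch G i))"
  unfolding U_mult Xi_def diag_mult by (rule sum.mono_neutral_cong_right) auto

text \<open>
  On \<open>S\<close> the equation \<open>(K\<^sub>d + (K - K\<^sub>d) \<Xi>) c = 0\<close> says that the Gram matrix of the closed switches with
  respect to the inverse Laplacian annihilates \<open>c\<close>; off \<open>S\<close> it determines \<open>c\<close>.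
\<close>

lemma invertible_coupling_iff:
  fixes G :: "('v, 'e::finite, 'm::finite, 'n::finite) grid"
  assumes A: "pos_def (B_r G)" and diag: "\<And>i. K G $ i $ i > 0"
  shows "invertible (K_d G + (K G - K_d G) ** Xi S) \<longleftrightarrow>
    (\<forall>c. (\<Sum>i\<in>S. c i *\<^sub>R nu G (switch G i)) = 0 \<longrightarrow> (\<forall>i\<in>S. c i = 0))"
    (is "invertible ?N \<longleftrightarrow> ?indep")
proof
  assume inv: "invertible ?N"
  show ?indep
  proof (intro allI impI ballI)
    fix c :: "'m \<Rightarrow> real" and i
    assume c: "(\<Sum>i\<in>S. c i *\<^sub>R nu G (switch G i)) = 0" and "i \<in> S"
    \<comment> \<open>Zero outside \<open>S\<close>, so that the diagonal term vanishes in those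
      rows too.\<close>
    let ?c = "\<chi> i. if i \<in> S then c i else 0"
    have "U G *v (Xi S *v ?c) = 0" by (simp add: U_Xi_mult c)
    then have "K G *v (Xi S *v ?c) = 0" by (simp only: K_mult matrix_vector_mult_0_right)
    then have "?N *v ?c = 0" by (simp add: vec_eq_iff coupling_matrix_mult)
    then have "?c = 0" using inv by (simp add: invertible_iff_ker)
    with \<open>i \<in> S\<close> show "c i = 0" by (auto simp: vec_eq_iff dest: spec[of _ i])
  qed
next
  assume indep: ?indep
  show "invertible ?N"
    unfolding invertible_iff_ker
  proof (intro allI impI)
    fix c assume N: "?N *v c = 0"
    define z where "z = U G *v (Xi S *v c)"
    have Kc: "(K G *v (Xi S *v c)) $ i = nu G (switch G i) \<bullet> (matrix_inv (B_r G) *v z)" for i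
      by (simp only: K_mult transpose_U_mult z_def)
    have N': "(if i \<in> S then 0 else K G $ i $ i * c $ i)
        + nu G (switch G i) \<bullet> (matrix_inv (B_r G) *v z) = 0" for i
      using coupling_matrix_mult[of G S c i] N by (simp add: Kc)
    \<comment> \<open>Every summand vanishes by the rows in \<open>S\<close>, so positivity of the
      inverse Laplacian forces \<open>z = 0\<close>.\<close>
    have "z \<bullet> (matrix_inv (B_r G) *v z)
        = (\<Sum>i\<in>S. c $ i * (nu G (switch G i) \<bullet> (matrix_inv (B_r G) *v z)))"
      by (subst (1) z_def) (simp add: U_Xi_mult inner_sum_left)
    also have "\<dots> = 0"
    proof (intro sum.neutral ballI)
      fix i assume "i \<in> S"
      then show "c $ i * (nu G (switch G i) \<bullet> (matrix_inv (B_r G) *v z)) = 0"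
        using N'[of i] by simp
    qed
    finally have "z = 0"
      using pos_defD[OF pos_def_matrix_inv[OF A], of z] by (cases "z = 0") simp_all
    then have "c $ i = 0" if "i \<in> S" for i
      using indep[rule_format, of "\<lambda>i. c $ i"] that by (simp add: z_def U_Xi_mult)
    moreover have "c $ i = 0" if "i \<notin> S" for i
      using N'[of i] that \<open>z = 0\<close> diag[of i] by simp
    ultimately show "c = 0" by (auto simp: vec_eq_iff)
  qed
qed

lemma B_m_inv_formula:
  fixes G :: "('v, 'e::finite, 'm::finite, 'n::finite) grid"
  assumes A: "pos_def (B_r G)" and inv: "invertible (K_d G + (K G - K_d G) ** Xi S)"
  shows "B_m_inv G S = matrix_inv (B_r G) -
    matrix_inv (B_r G) ** U G ** Xi S ** matrix_inv (K_d G + (K G - K_d G) ** Xi S)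
      ** transpose (U G) ** matrix_inv (B_r G)"
    (is "_ = ?X")
  unfolding matrix_eq
proof
  fix p
  let ?N = "K_d G + (K G - K_d G) ** Xi S"
  let ?A' = "matrix_inv (B_r G)"
  \<comment> \<open>On \<open>S\<close> the entries of \<open>y\<close> serve as the multipliers
    that express \<open>p - B_r G *v w\<close> for the candidate solution
    \<open>w = ?X *v p\<close>.\<close>
  define y where "y = matrix_inv ?N *v (transpose (U G) *v (?A' *v p))"
  have X: "?X *v p = ?A' *v p - ?A' *v (U G *v (Xi S *v y))"
    by (simp add: y_def matrix_vector_mult_diff_rdistrib matrix_vector_mul_assoc matrix_mul_assoc)
  have Ny: "?N *v y = transpose (U G) *v (?A' *v p)"
    unfolding y_def by (rule matrix_inv_vector_mul[OF inv])
  show "B_m_inv G S *v p = ?X *v p"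
  proof (rule B_m_inv_mult_eqI[OF A])
    fix i assume "i \<in> S"
    \<comment> \<open>In a row of \<open>S\<close> the coupling matrix reduces to its
      \<open>K\<close> term, so the two parts of \<open>?X *v p\<close> cancel when paired with this
      switch column.\<close>
    then have "nu G (switch G i) \<bullet> (?A' *v p) = (K G *v (Xi S *v y)) $ i"
      unfolding transpose_U_mult[symmetric] Ny[symmetric] by (simp add: coupling_matrix_mult)
    also have "\<dots> = nu G (switch G i) \<bullet> (?A' *v (U G *v (Xi S *v y)))"
      by (simp only: K_mult transpose_U_mult)
    finally show "nu G (switch G i) \<bullet> (?X *v p) = 0"
      unfolding X by (simp add: inner_diff_right)
  next
    show "p = B_r G *v (?X *v p) + (\<Sum>i\<in>S. y $ i *\<^sub>R nu G (switch G i))"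
      unfolding X U_Xi_mult matrix_vector_mult_diff_distrib
        matrix_inv_vector_mul[OF pos_def_invertible[OF A]] by simp
  qed
qed

section \<open>Power flow\<close>

text \<open>Angles vanishing at the slack bus are exactly the potentials
  \<open>bus_angle G x\<close>, and the balance at the non-slack buses becomes the grounded
  Laplacian equation.\<close>

lemma dc_power_flow_iff:
  fixes G :: "('v::finite, 'e::finite, 'm::finite, 'n::finite) grid"
  assumes G: "valid_grid G"
  shows "dc_power_flow G \<beta> p \<theta> f \<longleftrightarrow>
    (\<exists>x. \<theta> = bus_angle G x \<and> f = (\<lambda>e. \<beta> e * (nu G e \<bullet> x)) \<and>
      (\<Sum>e\<in>UNIV. (\<beta> e * (nu G e \<bullet> x)) *\<^sub>R nu G e) = p)"
proof -
  have balance: "(\<Sum>e | src G e = row_bus G n. f e) - (\<Sum>e | dst G e = row_bus G n. f e)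
      = (\<Sum>e\<in>UNIV. f e *\<^sub>R nu G e) $ n" for f n
  proof -
    have "(\<Sum>e\<in>UNIV. f e *\<^sub>R nu G e) $ n = (\<Sum>e\<in>UNIV.
        (if src G e = row_bus G n then f e else 0) - (if dst G e = row_bus G n then f e else 0))"
      unfolding sum_component
    proof (rule sum.cong[OF refl])
      fix e
      show "(f e *\<^sub>R nu G e) $ n = (if src G e = row_bus G n then f e else 0)
          - (if dst G e = row_bus G n then f e else 0)"
        using valid_gridD(1)[OF G, of e] by (auto simp: nu_nth incidence_def)
    qed
    then show ?thesis by (simp add: sum_subtractf sum.If_cases)
  qed
  have "dc_power_flow G \<beta> p \<theta> f \<longleftrightarrow> (\<exists>x. \<theta> = bus_angle G x) \<and>
      (\<forall>e. f e = \<beta> e * (\<theta> (src G e) - \<theta> (dst G e))) \<and> (\<Sum>e\<in>UNIV. f e *\<^sub>R nu G e) = p"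
    unfolding dc_power_flow_def balance vec_eq_iff
    by (metis bus_angle_of[OF G] bus_angle_slack)
  then show ?thesis by (auto simp: nu_inner[OF G] fun_eq_iff)
qed

lemma branch_flow_setting:
  fixes G :: "('v::finite, 'e::finite, 'm::finite, 'n::finite) grid"
  assumes G: "valid_grid G" and inv: "invertible (B_finite G S t)"
  shows "branch_flow G (setting_suscept G S t) p a
    = setting_suscept G S t a * (nu G a \<bullet> (matrix_inv (B_finite G S t) *v p))"
proof -
  have "B_finite G S t *v x = p \<longleftrightarrow> x = matrix_inv (B_finite G S t) *v p" for x
    using matrix_inv_vector_mul[OF inv] by metis
  then show ?thesis
    unfolding branch_flow_def dc_power_flow_iff[OF G] B_finite_mult_switch[OF G, symmetric]
    by (intro the_equality) auto
qed

text \<open>The susceptance of \<open>a\<close> stays fixed during the limit, as \<open>a\<close> is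
  not a switch. The flow is matched with the matrix expression eventually, namely where all
  \<open>t i\<close> with \<open>i\<close> in \<open>S\<close> are positive.\<close>

lemma setting_flow_eq:
  fixes G :: "('v::finite, 'e::finite, 'm::finite, 'n::finite) grid"
  assumes G: "valid_grid G" and A: "pos_def (B_r G)" and a: "a \<notin> range (switch G)"
  shows "setting_flow G S p a = suscept G a * (nu G a \<bullet> (B_m_inv G S *v p))"
  unfolding setting_flow_def
proof (rule tendsto_Lim[OF closing_nontrivial])
  have "((\<lambda>t. suscept G a * (nu G a \<bullet> (matrix_inv (B_finite G S t) *v p)))
      \<longlongrightarrow> suscept G a * (nu G a \<bullet> (B_m_inv G S *v p))) (closing S)"
    by (intro tendsto_intros tendsto_matrix_vector_mult B_finite_inv_limit A)
  then show "((\<lambda>t. branch_flow G (setting_suscept G S t) p a)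
      \<longlongrightarrow> suscept G a * (nu G a \<bullet> (B_m_inv G S *v p))) (closing S)"
  proof (rule Lim_transform_eventually)
    show "\<forall>\<^sub>F t in closing S. suscept G a * (nu G a \<bullet> (matrix_inv (B_finite G S t) *v p))
        = branch_flow G (setting_suscept G S t) p a"
      using eventually_closing_pos
    proof (rule eventually_mono)
      fix t assume "\<forall>i\<in>S. t i > (0::real)"
      then show "suscept G a * (nu G a \<bullet> (matrix_inv (B_finite G S t) *v p))
          = branch_flow G (setting_suscept G S t) p a"
        using a by (simp add: branch_flow_setting[OF G invertible_B_finite[OF A]]
            setting_suscept_def)
    qed
  qed
qed

text \<open>The flow is linear in \<open>p\<close>, and evaluating it at basis vectors shows that
  its coefficients are unique, as \<open>THE\<close> requires.\<close>

lemma PTDF_eq: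
  fixes G :: "('v::finite, 'e::finite, 'm::finite, 'n::finite) grid"
  assumes "valid_grid G" and "pos_def (B_r G)" and "a \<notin> range (switch G)"
  shows "PTDF G S a i = suscept G a * (nu G a \<bullet> (B_m_inv G S *v axis i 1))"
proof -
  let ?c = "\<lambda>i. suscept G a * (nu G a \<bullet> (B_m_inv G S *v axis i 1))"
  have "PTDF G S a = ?c"
    unfolding PTDF_def
  proof (rule the_equality)
    show "\<forall>p. setting_flow G S p a = (\<Sum>i\<in>UNIV. ?c i * p $ i)"
      unfolding setting_flow_eq[OF assms] matrix_vector_mult_basis
      by (simp add: matrix_mult_sum scalar_mult_eq_scaleR inner_sum_right sum_distrib_left mult_ac)
  next
    fix c assume c: "\<forall>p. setting_flow G S p a = (\<Sum>i\<in>UNIV. c i * p $ i)"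
    show "c = ?c"
    proof
      fix j
      have "?c j = (\<Sum>i\<in>UNIV. c i * axis j 1 $ i)"
        using c setting_flow_eq[OF assms] by metis
      also have "\<dots> = c j"
        by (simp add: axis_def if_distrib[of "\<lambda>x. _ * x"] cong: if_cong)
      finally show "c j = ?c j" ..
    qed
  qed
  then show ?thesis by simp
qed

text \<open>Rewritten as \<open>1 - 1 / (1 + t * q)\<close>, whose denominator tends to infinity and
  is positive for \<open>t \<ge> 0\<close>.\<close>

lemma xi_tendsto:
  assumes "nu G (switch G i) \<bullet> (matrix_inv (B_r G) *v nu G (switch G i)) > 0"
  shows "(xi G i \<longlongrightarrow> 1) at_top"
proof -
  let ?q = "nu G (switch G i) \<bullet> (matrix_inv (B_r G) *v nu G (switch G i))"
  have "filterlim (\<lambda>t. 1 + t * ?q) at_top at_top"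
    by (intro filterlim_tendsto_add_at_top[OF tendsto_const]
        filterlim_at_top_mult_tendsto_pos[OF tendsto_const assms] filterlim_ident)
  then have "((\<lambda>t. 1 - 1 / (1 + t * ?q)) \<longlongrightarrow> 1 - 0) at_top"
    by (intro tendsto_diff tendsto_const real_tendsto_divide_at_top[OF tendsto_const])
  moreover have "\<forall>\<^sub>F t in at_top. 1 - 1 / (1 + t * ?q) = xi G i t"
    using eventually_ge_at_top[of 0]
  proof eventually_elim
    case (elim t)
    then have "1 + t * ?q > 0" using assms by (simp add: add_pos_nonneg)
    then show ?case by (simp add: xi_def Let_def field_simps)
  qed
  ultimately show ?thesis using Lim_transform_eventually by fastforce
qed

text \<open>Convergence is asserted explicitly because \<open>Lim\<close> has a value even without
  it. The closed formula is tied to the absence of loops because with a loop the matrix in it is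
  singular; the limit and the distribution factors are covered for every switch setting.\<close>

theorem mainTheorem5:
  fixes G :: "('v::finite, 'e::finite, 'm::finite, 'n::finite) grid"
    and S :: "'m set"
  assumes "valid_grid G"
    and "connected_all_open G"
  shows "(\<forall>i. (i \<in> S \<longrightarrow> (xi G i \<longlongrightarrow> Xi S $ i $ i) at_top) \<and>
              (i \<notin> S \<longrightarrow> xi G i 0 = Xi S $ i $ i)) \<and>
         ((\<lambda>t. matrix_inv (B_finite G S t)) \<longlongrightarrow> B_m_inv G S) (closing S) \<and>
         (invertible (K_d G + (K G - K_d G) ** Xi S) \<longleftrightarrow> no_closed_loop G S) \<and>
         (no_closed_loop G S \<longrightarrow>
            B_m_inv G S =
              matrix_inv (B_r G) -
              matrix_inv (B_r G) ** U G ** Xi S ** matrix_inv (K_d G + (K G - K_d G) ** Xi S)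
                ** transpose (U G) ** matrix_inv (B_r G)) \<and>
         (\<forall>a i. a \<notin> range (switch G) \<longrightarrow>
            PTDF G S a i = suscept G a * (nu G a \<bullet> (B_m_inv G S *v axis i 1)))"
proof -
  have A: "pos_def (B_r G)" by (rule pos_def_B_r[OF assms])
  have q: "nu G (switch G i) \<bullet> (matrix_inv (B_r G) *v nu G (switch G i)) > 0" for i
    by (rule pos_defD[OF pos_def_matrix_inv[OF A] nu_nonzero[OF assms(1)]])
  have xi: "(i \<in> S \<longrightarrow> (xi G i \<longlongrightarrow> Xi S $ i $ i) at_top) \<and>
      (i \<notin> S \<longrightarrow> xi G i 0 = Xi S $ i $ i)" for i
    using xi_tendsto[OF q] by (simp add: Xi_def diag_def xi_def Let_def)
  have inv: "invertible (K_d G + (K G - K_d G) ** Xi S) \<longleftrightarrow> no_closed_loop G S"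
    using invertible_coupling_iff[OF A, unfolded K_nth, OF q]
      no_closed_loop_iff_independent[OF assms(1)] by blast
  show ?thesis
    using xi B_finite_inv_limit[OF A] inv B_m_inv_formula[OF A] PTDF_eq[OF assms(1) A] by blast
qed

end
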